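(* Let $m\ge 2$ and let $\mathcal F=\{f_j\}_{j=1}^n$ be a unit-norm frame of $n$ vectors in $\mathbb R^m$. Let $d_1=\frac{(m+2)(m-1)}{2}$ and $d_2=\frac12(d_1+2)(d_1-1)$, and let $\mathbf Q^{(2)}$ be the second zero-mean tensor embedding. (1) If $$\frac{n-d_1}{n-1}\ \ge\ \frac{d_1}{(m-1)^2}$$ and $\{\mathbf Q^{(2)}(f): f\in\mathcal F\}$ forms a simplex in a subspace of $\mathcal B_{SA}(\mathbb R^m)^{\otimes 2}$, then $\mathcal F$ is a Grassmannian frame. (2) If $n>d_2+1$, $(m-1)^2\ge d_1$, and $\langle \mathbf Q^{(2)}(f_j),\mathbf Q^{(2)}(f_l)\rangle_{HS}\le 0$ for all $j\ne l$, then $\mathcal F$ is a Grassmannian frame.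
   Context: A unit-norm frame of $n$ vectors for $\mathbb R^m$ is a sequence $\{f_j\}_{j=1}^n$ of unit vectors spanning $\mathbb R^m$. Its coherence is $\mu(\mathcal F)=\max_{j\ne l}|\langle f_j,f_l\rangle|$. It is a Grassmannian frame if its coherence is minimal among all unit-norm frames of $n$ vectors for $\mathbb R^m$. $\mathcal B_{SA}(\mathbb R^m)$ is the real vector space of self-adjoint linear maps on $\mathbb R^m$; $\mathcal B_{SA}(\mathbb R^m)^{\otimes 2}$ is regarded as a space of self-adjoint operators on $\mathbb R^m\otimes\mathbb R^m$ and carries the Hilbert-Schmidt inner product $\langle A,B\rangle_{HS}=\operatorname{tr}(AB^* )$. Let $\omega$ be a random vector uniformly distributed on the unit sphere of $\mathbb R^m$, with expectation $\mathbb E$. For a unit vector $x\in\mathbb R^m$ define $$\mathbf Q^{(1)}(x)=x\otimes x^*-\tfrac1m\mathbf I_m\in\mathcal B_{SA}(\mathbb R^m),\qquad \mathbf Q^{(2)}(x)=\mathbf Q^{(1)}(x)\otimes\mathbf Q^{(1)}(x)-\mathbb E\big[\mathbf Q^{(1)}(\omega)\otimes\mathbf Q^{(1)}(\omega)\big],$$ where $x\otimes x^*$ is the rank-one operator $y\mapsto\langle y,x\rangle x$. The norm $\|\mathbf Q^{(2)}(x)\|_{HS}$ is the same nonzero constant for all unit vectors $x$ when $m\ge2$. "$\{\mathbf Q^{(2)}(f): f\in\mathcal F\}$ forms a simplex" means that the $n$ normalized vectors $\mathbf Q^{(2)}(f_j)/\|\mathbf Q^{(2)}(f_j)\|_{HS}$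 are the vertices of a regular simplex centered at the origin, i.e. their pairwise Hilbert-Schmidt inner products for $j\neq l$ all equal $-\frac1{n-1}$. *)

theory Defs
  imports "HOL-Probability.Probability"
begin

section \<open>Unit-norm frames\<close>

text \<open>A sequence of \<open>n\<close> vectors is a function on \<open>nat\<close> of which only the values at
  \<open>1, \<dots>, n\<close> matter.\<close>

definition unit_norm_frame :: "nat \<Rightarrow> (nat \<Rightarrow> real^'m) \<Rightarrow> bool" where
  "unit_norm_frame n f \<longleftrightarrow> (\<forall>j\<in>{1..n}. norm (f j) = 1) \<and> span (f ` {1..n}) = UNIV"

definition coherence :: "nat \<Rightarrow> (nat \<Rightarrow> real^'m) \<Rightarrow> real" where
  "coherence n f = Max {\<bar>f j \<bullet> f l\<bar> | j l. j \<in> {1..n} \<and> l \<in> {1..n} \<and> j \<noteq> l}"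

definition grassmannian_frame :: "nat \<Rightarrow> (nat \<Rightarrow> real^'m) \<Rightarrow> bool" where
  "grassmannian_frame n f \<longleftrightarrow> unit_norm_frame n f \<and>
     (\<forall>g :: nat \<Rightarrow> real^'m. unit_norm_frame n g \<longrightarrow> coherence n f \<le> coherence n g)"


section \<open>Operators on \<open>\<real>\<^sup>m\<close> and on \<open>\<real>\<^sup>m \<otimes> \<real>\<^sup>m\<close>\<close>

text \<open>Operators are represented by their matrices in the standard basis. The space
  \<open>\<real>\<^sup>m \<otimes> \<real>\<^sup>m\<close> is the space of vectors indexed by pairs, with
  \<open>e\<^sub>i \<otimes> e\<^sub>j\<close> corresponding to \<open>axis (i, j) 1\<close>; the tensor product of
  operators is then the Kronecker product.\<close>

definition tensor_vec :: "real^'m \<Rightarrow> real^'m \<Rightarrow> real^('m \<times> 'm)" where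
  "tensor_vec x y = (\<chi> p. x $ fst p * y $ snd p)"

definition tensor_op :: "real^'m^'m \<Rightarrow> real^'m^'m \<Rightarrow> real^('m \<times> 'm)^('m \<times> 'm)" where
  "tensor_op A B = (\<chi> p q. A $ fst p $ fst q * B $ snd p $ snd q)"

lemma tensor_op_mult_tensor_vec:
  "tensor_op A B *v tensor_vec x y = tensor_vec (A *v x) (B *v y)"
  by (simp add: tensor_op_def tensor_vec_def matrix_vector_mult_def vec_eq_iff sum_product
      sum.cartesian_product case_prod_unfold mult_ac flip: UNIV_Times_UNIV)

definition self_adjoint_ops :: "(real^'k^'k) set" where
  "self_adjoint_ops = {A. transpose A = A}"

definition self_adjoint_tensor_square :: "(real^('m::finite \<times> 'm)^('m \<times> 'm)) set" where
  "self_adjoint_tensor_square =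
     span {tensor_op A B | A B. A \<in> self_adjoint_ops \<and> B \<in> self_adjoint_ops}"

definition hs_inner :: "real^'k^'k \<Rightarrow> real^'k^'k \<Rightarrow> real" where
  "hs_inner A B = trace (A ** transpose B)"

definition hs_norm :: "real^'k^'k \<Rightarrow> real" where
  "hs_norm A = sqrt (hs_inner A A)"

lemma hs_inner_eq_inner: "hs_inner A B = A \<bullet> B"
  by (simp add: hs_inner_def trace_def matrix_matrix_mult_def transpose_def inner_vec_def)


section \<open>The uniform distribution on the unit sphere\<close>

text \<open>The law of \<open>X / \<parallel>X\<parallel>\<close> for \<open>X\<close> uniformly distributed in the unit ball. The
  lemmas below show that it is a rotation-invariant probability measure concentrated on the
  unit sphere.\<close>

definition sphere_uniform :: "'a::euclidean_space measure" where
  "sphere_uniform = distr (uniform_measure lborel (ball 0 1)) borel (\<lambda>x. x /\<^sub>R norm x)"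

lemma emeasure_unit_ball:
  "emeasure lborel (ball (0::'a::euclidean_space) 1) \<noteq> 0"
  "emeasure lborel (ball (0::'a::euclidean_space) 1) \<noteq> \<infinity>"
proof -
  show "emeasure lborel (ball (0::'a) 1) \<noteq> \<infinity>"
    using emeasure_lborel_ball_finite[of "0::'a" 1] by simp
  have "0 < measure lborel (ball (0::'a) 1)" by (rule content_ball_pos) simp
  then show "emeasure lborel (ball (0::'a) 1) \<noteq> 0"
    by (auto simp: measure_def)
qed

lemma prob_space_sphere_uniform: "prob_space (sphere_uniform :: 'a::euclidean_space measure)"
  unfolding sphere_uniform_def
  by (intro prob_space.prob_space_distr prob_space_uniform_measure emeasure_unit_ball)
     (simp_all add: emeasure_unit_ball)

lemma AE_sphere_uniform: "AE x in (sphere_uniform :: 'a::euclidean_space measure). norm x = 1"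
proof -
  have "AE x in lborel. x \<noteq> (0::'a)"
    by (rule AE_lborel_singleton)
  then have "AE x in uniform_measure lborel (ball (0::'a) 1). norm (x /\<^sub>R norm x) = 1"
    by (intro AE_uniform_measureI) auto
  then show ?thesis
    unfolding sphere_uniform_def by (subst AE_distr_iff) simp_all
qed

lemma distr_lborel_orthogonal:
  fixes T :: "'a::euclidean_space \<Rightarrow> 'a"
  assumes T: "orthogonal_transformation T"
  shows "distr lborel borel T = lborel"
proof -
  have lin: "linear T" and surj: "surj T" and nT: "\<And>x. norm (T x) = norm x"
    using T by (auto simp: orthogonal_transformation_linear orthogonal_transformation_surj
        orthogonal_transformation_norm)
  have mT[measurable]: "T \<in> borel_measurable borel"
    using lin by (intro borel_measurable_continuous_onI linear_continuous_on linear_conv_bounded_linear[THEN iffD1])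
  define \<nu> where "\<nu> = distr lborel borel T"
  have sets\<nu>[measurable_cong, simp]: "sets \<nu> = sets borel" and [simp]: "space \<nu> = UNIV"
    by (simp_all add: \<nu>_def)
  have int: "(\<integral>\<^sup>+x. g x \<partial>\<nu>) = (\<integral>\<^sup>+x. g (T x) \<partial>lborel)" if [measurable]: "g \<in> borel_measurable borel" for g
    unfolding \<nu>_def by (simp add: nn_integral_distr)
  have shl: "(\<integral>\<^sup>+x. g (a + x) \<partial>lborel) = (\<integral>\<^sup>+x. g x \<partial>lborel)"
    if [measurable]: "g \<in> borel_measurable borel" for g :: "'a \<Rightarrow> ennreal" and a
    by (subst (2) lborel_distr_plus[of a, symmetric], subst nn_integral_distr) simp_all
  have sh\<nu>: "(\<integral>\<^sup>+x. g (a + x) \<partial>\<nu>) = (\<integral>\<^sup>+x. g x \<partial>\<nu>)"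
    if [measurable]: "g \<in> borel_measurable borel" for g :: "'a \<Rightarrow> ennreal" and a
  proof -
    obtain b where b: "a = T b" using surj by (metis surjD)
    show ?thesis using shl[of "\<lambda>x. g (T x)" b] by (simp add: int b linear_add[OF lin])
  qed
  have \<nu>ball: "emeasure \<nu> (ball 0 r) = emeasure lborel (ball (0::'a) r)" for r
  proof -
    have "T -` ball 0 r = ball 0 r" using nT by (auto simp: dist_norm)
    then show ?thesis by (simp add: \<nu>_def emeasure_distr)
  qed
  have sf: "sigma_finite_measure \<nu>"
  proof (rule sigma_finite_measure.intro, intro exI[of _ "range (\<lambda>n::nat. ball 0 (real n))"] conjI)
    show "\<Union> (range (\<lambda>n::nat. ball (0::'a) (real n))) = space \<nu>"
      by (auto simp: dist_norm intro: reals_Archimedean2)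
  qed (use emeasure_lborel_ball_finite[of "0::'a"] in \<open>auto simp: \<nu>ball less_top\<close>)
  interpret L: sigma_finite_measure "lborel :: 'a measure" by (rule sigma_finite_lborel)
  interpret N: sigma_finite_measure \<nu> by (rule sf)
  interpret P: pair_sigma_finite "lborel :: 'a measure" \<nu> ..
  let ?B = "ball (0::'a) 1"
  have [measurable]: "?B \<in> sets borel" by simp
  have "emeasure \<nu> A = emeasure lborel A" if [measurable]: "A \<in> sets borel" for A
  proof -
    let ?a = "indicator A :: 'a \<Rightarrow> ennreal" and ?b = "indicator ?B :: 'a \<Rightarrow> ennreal"
    have "emeasure \<nu> A * emeasure lborel ?B = (\<integral>\<^sup>+x. (\<integral>\<^sup>+y. ?a x * ?b y \<partial>lborel) \<partial>\<nu>)"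
      by (simp add: nn_integral_cmult_indicator nn_integral_multc)
    also have "\<dots> = (\<integral>\<^sup>+x. (\<integral>\<^sup>+y. ?a x * ?b (- x + y) \<partial>lborel) \<partial>\<nu>)"
      by (rule nn_integral_cong, rule shl[of "\<lambda>y. ?a x * ?b y" "- x" for x, symmetric]) measurable
    also have "\<dots> = (\<integral>\<^sup>+y. (\<integral>\<^sup>+x. ?a x * ?b (- x + y) \<partial>\<nu>) \<partial>lborel)"
      by (rule P.Fubini') measurable
    also have "\<dots> = (\<integral>\<^sup>+y. (\<integral>\<^sup>+x. ?a (y + x) * ?b (- (y + x) + y) \<partial>\<nu>) \<partial>lborel)"
      by (rule nn_integral_cong, rule sh\<nu>[of "\<lambda>x. ?a x * ?b (- x + y)" y for y, symmetric]) measurable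
    also have "\<dots> = (\<integral>\<^sup>+y. (\<integral>\<^sup>+x. ?a (x + y) * ?b x \<partial>\<nu>) \<partial>lborel)"
      by (intro nn_integral_cong) (auto simp: indicator_def dist_norm add.commute)
    also have "\<dots> = (\<integral>\<^sup>+x. (\<integral>\<^sup>+y. ?a (x + y) * ?b x \<partial>lborel) \<partial>\<nu>)"
      by (rule P.Fubini'[symmetric]) measurable
    also have "\<dots> = (\<integral>\<^sup>+x. (\<integral>\<^sup>+y. ?a y * ?b x \<partial>lborel) \<partial>\<nu>)"
      by (rule nn_integral_cong, rule shl[of "\<lambda>y. ?a y * ?b x" x for x]) measurable
    also have "\<dots> = emeasure lborel A * emeasure lborel ?B"
      by (simp add: nn_integral_multc nn_integral_cmult_indicator \<nu>ball)
    finally show ?thesis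
      using emeasure_unit_ball[where 'a='a] by (simp add: mult.commute[of _ "emeasure lborel ?B"] ennreal_mult_cancel_left)
  qed
  then show ?thesis unfolding \<nu>_def[symmetric] by (intro measure_eqI) simp_all
qed

lemma sphere_uniform_rotation_invariant:
  fixes T :: "'a::euclidean_space \<Rightarrow> 'a"
  assumes T: "orthogonal_transformation T"
  shows "distr sphere_uniform borel T = sphere_uniform"
proof -
  have lin: "linear T" and nT: "\<And>x. norm (T x) = norm x"
    using T by (auto simp: orthogonal_transformation_linear orthogonal_transformation_norm)
  have [measurable]: "T \<in> borel_measurable borel"
    using lin by (intro borel_measurable_continuous_onI linear_continuous_on linear_conv_bounded_linear[THEN iffD1])
  let ?U = "uniform_measure lborel (ball (0::'a) 1)"
  have "distr ?U borel T = ?U"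
  proof (rule measure_eqI)
    fix A assume "A \<in> sets (distr ?U borel T)"
    then have [measurable]: "A \<in> sets borel" by simp
    have [measurable]: "T -` A \<in> sets borel"
      using measurable_sets_borel[of T borel A] by simp
    have "ball 0 1 \<inter> T -` A = T -` (ball 0 1 \<inter> A)" using nT by (auto simp: dist_norm)
    moreover have "emeasure lborel (T -` (ball 0 1 \<inter> A)) = emeasure lborel (ball 0 1 \<inter> A)"
      using emeasure_distr[of T lborel borel "ball 0 1 \<inter> A"] by (simp add: distr_lborel_orthogonal[OF T])
    ultimately show "emeasure (distr ?U borel T) A = emeasure ?U A"
      by (simp add: emeasure_distr del: vimage_Int)
  qed simp
  then have "sphere_uniform = distr (distr ?U borel T) borel (\<lambda>x. x /\<^sub>R norm x)"
    by (simp add: sphere_uniform_def)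
  also have "\<dots> = distr ?U borel (\<lambda>x. T (x /\<^sub>R norm x))"
    by (subst distr_distr) (simp_all add: comp_def nT linear_scale[OF lin])
  also have "\<dots> = distr sphere_uniform borel T"
    unfolding sphere_uniform_def by (subst distr_distr) (simp_all add: comp_def)
  finally show ?thesis by simp
qed


section \<open>The zero-mean tensor embeddings\<close>

definition Q1 :: "real^'m \<Rightarrow> real^'m^'m" where
  "Q1 x = matrix (\<lambda>y. (y \<bullet> x) *\<^sub>R x) - (1 / real CARD('m)) *\<^sub>R mat 1"

definition Q2 :: "real^'m \<Rightarrow> real^('m \<times> 'm)^('m \<times> 'm)" where
  "Q2 x = tensor_op (Q1 x) (Q1 x)
     - (\<integral>\<omega>. tensor_op (Q1 \<omega>) (Q1 \<omega>) \<partial>sphere_uniform)"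

text \<open>Regularity of the simplex with vertices
  \<open>v\<^sub>j / \<parallel>v\<^sub>j\<parallel>\<close>, centered at the origin, is expressed by the pairwise inner
  products of its vertices.\<close>

definition forms_simplex_in ::
  "(real^'k^'k) set \<Rightarrow> nat \<Rightarrow> (nat \<Rightarrow> real^'k^'k) \<Rightarrow> bool" where
  "forms_simplex_in V n v \<longleftrightarrow> (\<forall>j\<in>{1..n}. v j \<in> V) \<and>
     (\<forall>j\<in>{1..n}. \<forall>l\<in>{1..n}. j \<noteq> l \<longrightarrow>
        hs_inner ((1 / hs_norm (v j)) *\<^sub>R v j) ((1 / hs_norm (v l)) *\<^sub>R v l)
          = - 1 / (real n - 1))"

lemma integrable_tensor_Q1:
  "integrable sphere_uniform (\<lambda>\<omega>::real^'m. tensor_op (Q1 \<omega>) (Q1 \<omega>))"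
proof -
  let ?F = "\<lambda>\<omega>::real^'m. tensor_op (Q1 \<omega>) (Q1 \<omega>)"
  interpret prob_space "sphere_uniform :: (real^'m) measure" by (rule prob_space_sphere_uniform)
  have cont: "continuous_on UNIV ?F"
    unfolding tensor_op_def Q1_def matrix_def
    by (simp add: mat_def inner_axis inner_commute[of "axis _ _"] inner_axis') (intro continuous_intros)
  have "compact (?F ` sphere 0 1)"
    by (intro compact_continuous_image continuous_on_subset[OF cont]) auto
  then obtain K where K: "\<And>x. norm x = 1 \<Longrightarrow> norm (?F x) \<le> K"
    by (metis (no_types, lifting) compact_imp_bounded bounded_iff imageI mem_sphere_0)
  have sets: "sets (sphere_uniform :: (real^'m) measure) = sets borel"
    by (simp add: sphere_uniform_def)
  show ?thesis
  proof (rule integrable_const_bound[of _ K])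
    show "AE x in sphere_uniform. norm (?F x) \<le> K"
      using AE_sphere_uniform by eventually_elim (rule K)
    show "?F \<in> borel_measurable sphere_uniform"
      using borel_measurable_continuous_onI[OF cont] by (simp cong: measurable_cong_sets add: sets)
  qed
qed

lemma Q1_self_adjoint: "Q1 x \<in> self_adjoint_ops"
  by (auto simp: self_adjoint_ops_def Q1_def matrix_def mat_def transpose_def vec_eq_iff
      inner_axis inner_axis' mult.commute)

lemma Q2_in_self_adjoint_tensor_square:
  fixes x :: "real^'m"
  shows "Q2 x \<in> self_adjoint_tensor_square"
proof -
  let ?S = "self_adjoint_tensor_square :: (real^('m::finite \<times> 'm)^('m \<times> 'm)) set"
  let ?I = "\<integral>\<omega>. tensor_op (Q1 \<omega>) (Q1 \<omega>) \<partial>(sphere_uniform :: (real^'m) measure)"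
  have S: "tensor_op (Q1 y) (Q1 y) \<in> ?S" for y :: "real^'m"
    unfolding self_adjoint_tensor_square_def using Q1_self_adjoint by (intro span_base) blast
  have sub: "subspace ?S" unfolding self_adjoint_tensor_square_def by (rule subspace_span)
  obtain u v where "u \<in> span ?S" "\<And>w. w \<in> span ?S \<Longrightarrow> orthogonal v w" and uv: "?I = u + v"
    by (rule orthogonal_subspace_decomp_exists[of ?S ?I]) blast
  then have u: "u \<in> ?S" and v: "\<And>w. w \<in> ?S \<Longrightarrow> orthogonal v w"
    using sub by (simp_all add: span_eq_iff[THEN iffD2])
  have "v \<bullet> ?I = (\<integral>\<omega>. v \<bullet> tensor_op (Q1 \<omega>) (Q1 \<omega>) \<partial>(sphere_uniform :: (real^'m) measure))"
    by (rule integral_inner_right[symmetric]) (use integrable_tensor_Q1 in auto)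
  also have "\<dots> = 0" using v S by (simp add: orthogonal_def)
  finally have "v \<bullet> v = 0" using v[OF u] by (simp add: uv inner_add_right orthogonal_def)
  then have "?I \<in> ?S" using u uv by simp
  then show ?thesis unfolding Q2_def by (intro subspace_diff[OF sub] S)
qed

end

theory Submission
  imports Defs
begin

text \<open>Let \<open>a = 1 / m\<close> and \<open>c\<^sub>0 = \<parallel>E[Q1 \<omega> \<otimes> Q1 \<omega>]\<parallel>\<^sup>2 = (1 - a)\<^sup>2 / d1\<close>. The second and fourth moments of the sphere give
  \<open>Q2 x \<bullet> Q2 y = ((x \<bullet> y)\<^sup>2 - a)\<^sup>2 - c\<^sub>0\<close> for unit vectors. In both parts the assumptions on \<open>f\<close> bound
  \<open>\<bar>(f j \<bullet> f l)\<^sup>2 - a\<bar>\<close> by some \<open>\<beta> \<ge> a\<close>, so a frame \<open>g\<close> of smaller coherence satisfies the same bound, with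
  equality only for orthogonal pairs. In (1), \<open>\<parallel>\<Sum>j. Q2 (g j)\<parallel>\<^sup>2 \<ge> 0\<close> then forces equality for all pairs and
  \<open>(\<Sum>j. Q2 (g j)) = 0\<close>. In (2), the \<open>Q2 (g j)\<close> have pairwise nonpositive inner products in a space
  of dimension at most \<open>d2\<close>, so all but one of them satisfy a nonnegative linear relation, and those with positive
  weight belong to vectors orthogonal to the remaining one. Pairing the relation with \<open>Q2\<close> of suitable
  unit vectors refutes both configurations.\<close>

section \<open>Linear algebra\<close>

lemma integral_in_subspace_AE:
  fixes f :: "'a \<Rightarrow> 'b::euclidean_space"
  assumes S: "subspace S" and f: "integrable M f" and AE: "AE x in M. f x \<in> S"
  shows "integral\<^sup>L M f \<in> S"
proof -
  obtain u v where "u \<in> span S" "\<And>w. w \<in> span S \<Longrightarrow> orthogonal v w"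
    and uv: "integral\<^sup>L M f = u + v"
    by (rule orthogonal_subspace_decomp_exists[of S "integral\<^sup>L M f"]) blast
  then have u: "u \<in> S" and v: "\<And>w. w \<in> S \<Longrightarrow> v \<bullet> w = 0"
    using S by (simp_all add: span_eq_iff[THEN iffD2] orthogonal_def)
  have "v \<bullet> integral\<^sup>L M f = (\<integral>x. v \<bullet> f x \<partial>M)"
    by (rule integral_inner_right[symmetric]) (use f in auto)
  also have "\<dots> = 0"
    by (rule integral_eq_zero_AE) (use AE v in \<open>auto elim: eventually_mono\<close>)
  finally have "v \<bullet> v = 0" using v[OF u] by (simp add: uv inner_add_right)
  then show ?thesis using u uv by simp
qed

lemma dim_bilinear_diagonal_le:
  fixes h :: "'a::euclidean_space \<Rightarrow> 'a \<Rightarrow> 'b::euclidean_space"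
  assumes h: "bilinear h"
  shows "2 * dim ((\<lambda>x. h x x) ` S) \<le> dim S * (dim S + 1)"
proof -
  obtain B where B: "B \<subseteq> S" "independent B" "S \<subseteq> span B" "card B = dim S"
    by (rule basis_exists)
  have finB: "finite B" using B(2) by (rule independent_imp_finite)
  obtain b where b: "bij_betw b {..<dim S} B"
    using ex_bij_betw_nat_finite[OF finB] B(4) by (auto simp: atLeast0LessThan)
  define P where "P = (SIGMA j:{..<dim S}. {..j})"
  define G where "G = (\<lambda>(j, i). h (b i) (b j) + h (b j) (b i)) ` P"
  have finG: "finite G" unfolding G_def P_def by auto
  have "2 * (\<Sum>j<d. Suc j) = d * (d + 1)" for d :: nat
    by (induction d) auto
  then have cardP: "2 * card P = dim S * (dim S + 1)"
    unfolding P_def by (subst card_SigmaI) auto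
  have sym: "h (b i) (b j) + h (b j) (b i) \<in> span G" if "i < dim S" "j < dim S" for i j
  proof (cases "i \<le> j")
    case True
    then have "(j, i) \<in> P" using that by (auto simp: P_def)
    then show ?thesis unfolding G_def by (intro span_base) (auto intro!: rev_image_eqI)
  next
    case False
    then have "(i, j) \<in> P" using that by (auto simp: P_def)
    then show ?thesis unfolding G_def
      by (intro span_base) (auto intro!: rev_image_eqI simp: add.commute)
  qed
  have "h x x \<in> span G" if "x \<in> S" for x
  proof -
    have "x \<in> range (\<lambda>u. \<Sum>v\<in>B. u v *\<^sub>R v)"
      using B(3) that span_finite[OF finB] by blast
    then obtain u where "x = (\<Sum>v\<in>B. u v *\<^sub>R v)" by blast
    also have "\<dots> = (\<Sum>i<dim S. u (b i) *\<^sub>R b i)"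
      by (rule sum.reindex_bij_betw[OF b, symmetric])
    finally have x: "x = (\<Sum>i<dim S. u (b i) *\<^sub>R b i)" .
    have hxx: "h x x = (\<Sum>i<dim S. \<Sum>j<dim S. (u (b i) * u (b j)) *\<^sub>R h (b i) (b j))"
      by (subst (1 2) x) (simp add: bilinear_sum[OF h] bilinear_lmul[OF h] bilinear_rmul[OF h] mult.commute
          flip: sum.cartesian_product)
    have "h x x = (\<Sum>i<dim S. \<Sum>j<dim S. (u (b i) * u (b j)) *\<^sub>R h (b j) (b i))"
      unfolding hxx by (subst sum.swap) (simp add: mult.commute)
    then have "2 *\<^sub>R h x x =
        (\<Sum>i<dim S. \<Sum>j<dim S. (u (b i) * u (b j)) *\<^sub>R (h (b i) (b j) + h (b j) (b i)))"
      using hxx by (simp add: scaleR_add_right sum.distrib scaleR_2)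
    also have "\<dots> \<in> span G" by (intro span_sum span_scale sym) auto
    finally have "(1/2) *\<^sub>R (2 *\<^sub>R h x x) \<in> span G" by (rule span_scale)
    then show ?thesis by simp
  qed
  then have "dim ((\<lambda>x. h x x) ` S) \<le> card G"
    by (intro dim_le_card finG) auto
  also have "\<dots> \<le> card P" unfolding G_def by (rule card_image_le) (auto simp: P_def)
  finally show ?thesis using cardP by linarith
qed

lemma dim_orthogonal_to_vector_less:
  fixes S :: "'a::euclidean_space set"
  assumes S: "S \<subseteq> span U" and e: "e \<in> span U" "e \<noteq> 0" and orth: "\<And>s. s \<in> S \<Longrightarrow> e \<bullet> s = 0"
  shows "dim S + 1 \<le> dim U"
proof -
  have "e \<notin> span S"
  proof
    assume "e \<in> span S"
    then have "orthogonal e e" by (rule orthogonal_to_span) (use orth in \<open>simp add: orthogonal_def\<close>)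
    then show False using e by (simp add: orthogonal_def)
  qed
  then have "dim (insert e S) = dim S + 1" by (simp add: dim_insert)
  moreover have "dim (insert e S) \<le> dim (span U)" using S e by (intro dim_subset) auto
  ultimately show ?thesis by (simp add: dim_span)
qed

lemma linear_relation_if_dim_less:
  fixes w :: "'i \<Rightarrow> 'a::euclidean_space"
  assumes I: "finite I" and dim: "dim (w ` I) < card I"
  obtains c :: "'i \<Rightarrow> real" where "\<exists>i\<in>I. c i \<noteq> 0" "(\<Sum>i\<in>I. c i *\<^sub>R w i) = 0"
proof (cases "inj_on w I")
  case True
  then have "dim (w ` I) < card (w ` I)" using dim by (simp add: card_image)
  then have "dependent (w ` I)" by (metis dim_eq_card_independent less_irrefl)
  then obtain u where u: "\<exists>v\<in>w ` I. u v \<noteq> 0" "(\<Sum>v\<in>w ` I. u v *\<^sub>R v) = 0"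
    using I by (auto simp: dependent_finite)
  then show ?thesis using that[of "\<lambda>i. u (w i)"] by (auto simp: sum.reindex[OF True])
next
  case False
  then obtain i j where ij: "i \<in> I" "j \<in> I" "i \<noteq> j" "w i = w j" by (auto simp: inj_on_def)
  let ?c = "\<lambda>k. (if k = i then 1 else 0) - (if k = j then 1 else 0) :: real"
  have "(\<Sum>k\<in>I. ?c k *\<^sub>R w k)
      = (\<Sum>k\<in>I. if k = i then w k else 0) - (\<Sum>k\<in>I. if k = j then w k else 0)"
    unfolding sum_subtractf[symmetric] by (rule sum.cong) auto
  also have "\<dots> = 0" using ij I by simp
  finally show ?thesis using ij by (intro that[of ?c] bexI[of _ i]) auto
qed

text \<open>Rankin's argument: in a linear relation, the positive part and the negative part are equal
  vectors, whose inner product is at most zero.\<close>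

lemma nonneg_linear_relation_if_obtuse:
  fixes w :: "'i \<Rightarrow> 'a::euclidean_space"
  assumes I: "finite I" and dim: "dim (w ` I) < card I"
    and obtuse: "\<And>i j. i \<in> I \<Longrightarrow> j \<in> I \<Longrightarrow> i \<noteq> j \<Longrightarrow> w i \<bullet> w j \<le> 0"
  obtains c :: "'i \<Rightarrow> real" where
    "\<And>i. c i \<ge> 0" "\<exists>i\<in>I. c i \<noteq> 0" "(\<Sum>i\<in>I. c i *\<^sub>R w i) = 0"
proof -
  obtain c :: "'i \<Rightarrow> real" where c: "\<exists>i\<in>I. c i \<noteq> 0" "(\<Sum>i\<in>I. c i *\<^sub>R w i) = 0"
    by (rule linear_relation_if_dim_less[OF I dim])
  let ?p = "\<lambda>i. max (c i) 0" and ?q = "\<lambda>i. max (- c i) 0"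
  define z where "z = (\<Sum>i\<in>I. ?p i *\<^sub>R w i)"
  have "z - (\<Sum>i\<in>I. ?q i *\<^sub>R w i) = (\<Sum>i\<in>I. c i *\<^sub>R w i)"
    unfolding z_def sum_subtractf[symmetric] by (rule sum.cong) (auto simp: max_def)
  then have z: "z = (\<Sum>i\<in>I. ?q i *\<^sub>R w i)" using c by simp
  have "z \<bullet> z = (\<Sum>i\<in>I. \<Sum>j\<in>I. (?p i * ?q j) * (w i \<bullet> w j))"
    by (subst (2) z, simp add: z_def inner_sum_left inner_sum_right sum_distrib_left mult_ac)
       (subst sum.swap, simp add: inner_commute mult_ac)
  also have "\<dots> \<le> 0"
  proof (intro sum_nonpos)
    fix i j assume "i \<in> I" "j \<in> I"
    show "(?p i * ?q j) * (w i \<bullet> w j) \<le> 0"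
    proof (cases "i = j")
      case False
      then show ?thesis using obtuse \<open>i \<in> I\<close> \<open>j \<in> I\<close> by (intro mult_nonneg_nonpos) auto
    qed (auto simp: max_def)
  qed
  finally have "z = 0" by (metis inner_gt_zero_iff not_le)
  show ?thesis
  proof (cases "\<exists>i\<in>I. c i > 0")
    case True
    then show ?thesis using that[of ?p] \<open>z = 0\<close> z_def by fastforce
  next
    case False
    then have "\<exists>i\<in>I. ?q i \<noteq> 0" using c(1) by (force simp: max_def)
    then show ?thesis using that[of ?q] \<open>z = 0\<close> z by fastforce
  qed
qed


section \<open>Moments of the uniform distribution on the sphere\<close>

lemma integrable_sphere_uniform_continuous:
  fixes h :: "'a::euclidean_space \<Rightarrow> real"
  assumes cont: "continuous_on UNIV h"
  shows "integrable sphere_uniform h"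
proof -
  interpret prob_space "sphere_uniform :: 'a measure" by (rule prob_space_sphere_uniform)
  have "compact (h ` sphere 0 1)"
    by (intro compact_continuous_image continuous_on_subset[OF cont]) auto
  then obtain K where K: "\<And>x. norm x = 1 \<Longrightarrow> norm (h x) \<le> K"
    by (metis (no_types, lifting) compact_imp_bounded bounded_iff imageI mem_sphere_0)
  have sets: "sets (sphere_uniform :: 'a measure) = sets borel"
    by (simp add: sphere_uniform_def)
  show ?thesis
  proof (rule integrable_const_bound[of _ K])
    show "AE x in sphere_uniform. norm (h x) \<le> K"
      using AE_sphere_uniform by eventually_elim (rule K)
    show "h \<in> borel_measurable sphere_uniform"
      using borel_measurable_continuous_onI[OF cont] by (simp cong: measurable_cong_sets add: sets)
  qed
qed

lemma integral_sphere_uniform_const: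
  "(\<integral>\<omega>. a \<partial>(sphere_uniform :: 'a::euclidean_space measure)) = (a::real)"
  by (simp add: prob_space.prob_space[OF prob_space_sphere_uniform])

lemma integral_sphere_uniform_cong:
  fixes h h' :: "'a::euclidean_space \<Rightarrow> real"
  assumes "continuous_on UNIV h" "continuous_on UNIV h'" "\<And>\<omega>. norm \<omega> = 1 \<Longrightarrow> h \<omega> = h' \<omega>"
  shows "(\<integral>\<omega>. h \<omega> \<partial>sphere_uniform) = (\<integral>\<omega>. h' \<omega> \<partial>sphere_uniform)"
proof (rule integral_cong_AE)
  show "AE \<omega> in sphere_uniform. h \<omega> = h' \<omega>"
    using AE_sphere_uniform by eventually_elim (rule assms)
qed (use assms in \<open>auto intro!: borel_measurable_integrable integrable_sphere_uniform_continuous\<close>)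

lemma sphere_moment_rotate:
  fixes x y :: "real^'m"
  assumes "norm x = norm y"
  shows "(\<integral>\<omega>. (x \<bullet> \<omega>) ^ k \<partial>sphere_uniform) = (\<integral>\<omega>. (y \<bullet> \<omega>) ^ k \<partial>sphere_uniform)"
proof -
  obtain T where T: "orthogonal_transformation T" "T y = x"
    using orthogonal_transformation_exists[of y x] assms by auto
  have mT: "T \<in> borel_measurable borel"
    using T(1) by (intro borel_measurable_continuous_onI linear_continuous_on
        linear_conv_bounded_linear[THEN iffD1] orthogonal_transformation_linear)
  have sets: "sets (sphere_uniform :: (real^'m) measure) = sets borel"
    by (simp add: sphere_uniform_def)
  have "(\<integral>\<omega>. (x \<bullet> \<omega>) ^ k \<partial>sphere_uniform) = (\<integral>\<omega>. (x \<bullet> \<omega>) ^ k \<partial>distr sphere_uniform borel T)"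
    by (simp add: sphere_uniform_rotation_invariant[OF T(1)])
  also have "\<dots> = (\<integral>\<omega>. (x \<bullet> T \<omega>) ^ k \<partial>sphere_uniform)"
    by (rule integral_distr) (use mT sets in \<open>auto cong: measurable_cong_sets\<close>)
  also have "\<dots> = (\<integral>\<omega>. (y \<bullet> \<omega>) ^ k \<partial>sphere_uniform)"
    using T by (metis orthogonal_transformation_def)
  finally show ?thesis .
qed

lemma sphere_second_moment:
  fixes x :: "real^'m"
  assumes x: "norm x = 1"
  shows "(\<integral>\<omega>. (x \<bullet> \<omega>)\<^sup>2 \<partial>sphere_uniform) = 1 / real CARD('m)"
proof -
  let ?a = "\<integral>\<omega>. (x \<bullet> \<omega>)\<^sup>2 \<partial>sphere_uniform"
  have "(1::real) = (\<integral>\<omega>. 1 \<partial>(sphere_uniform :: (real^'m) measure))"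
    by (rule integral_sphere_uniform_const[symmetric])
  also have "\<dots> = (\<integral>\<omega>. (\<Sum>b\<in>Basis. (b \<bullet> \<omega>)\<^sup>2) \<partial>(sphere_uniform :: (real^'m) measure))"
  proof (rule integral_sphere_uniform_cong)
    fix \<omega> :: "real^'m" assume "norm \<omega> = 1"
    then show "1 = (\<Sum>b\<in>Basis. (b \<bullet> \<omega>)\<^sup>2)"
      using euclidean_inner[of \<omega> \<omega>] by (simp add: norm_eq_1 power2_eq_square inner_commute)
  qed (intro continuous_intros)+
  also have "\<dots> = (\<Sum>b\<in>(Basis::(real^'m) set). \<integral>\<omega>. (b \<bullet> \<omega>)\<^sup>2 \<partial>sphere_uniform)"
    by (intro Bochner_Integration.integral_sum integrable_sphere_uniform_continuous continuous_intros)
  also have "\<dots> = (\<Sum>b\<in>(Basis::(real^'m) set). ?a)"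
    by (intro sum.cong refl sphere_moment_rotate) (simp add: x)
  finally show ?thesis by (simp add: field_simps)
qed

lemma sphere_fourth_moment:
  fixes x :: "real^'m"
  assumes x: "norm x = 1"
  shows "(\<integral>\<omega>. (x \<bullet> \<omega>) ^ 4 \<partial>sphere_uniform) = 3 / (real CARD('m) * (real CARD('m) + 2))"
proof -
  let ?a = "\<integral>\<omega>. (x \<bullet> \<omega>) ^ 4 \<partial>sphere_uniform"
  let ?n = "real CARD('m)"
  note int = integrable_sphere_uniform_continuous
  have mixed: "(\<integral>\<omega>. (b \<bullet> \<omega>)\<^sup>2 * (b' \<bullet> \<omega>)\<^sup>2 \<partial>sphere_uniform) = ?a / 3"
    if b: "b \<in> Basis" "b' \<in> Basis" "b \<noteq> b'" for b b' :: "real^'m"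
  proof -
    let ?s = "(b + b') /\<^sub>R sqrt 2" and ?d = "(b - b') /\<^sub>R sqrt 2"
    have ns: "norm ?s = 1" "norm ?d = 1"
      using b unfolding norm_eq_1
      by (simp_all add: inner_add_left inner_add_right inner_diff_left inner_diff_right inner_Basis
          power2_eq_square[symmetric] field_simps)
    have rot: "(\<integral>\<omega>. (v \<bullet> \<omega>) ^ 4 \<partial>sphere_uniform) = ?a" if "norm v = 1" for v :: "real^'m"
      by (rule sphere_moment_rotate) (simp only: that x)
    have id: "6 * ((p::real)\<^sup>2 * q\<^sup>2) = 2 * ((p + q) / sqrt 2) ^ 4 + 2 * ((p - q) / sqrt 2) ^ 4 - p ^ 4 - q ^ 4" for p q
    proof -
      have "sqrt 2 ^ 4 = (4::real)" by (simp add: power4_eq_xxxx)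
      then show ?thesis
        by (simp add: power_divide) (simp add: power4_eq_xxxx power2_eq_square field_simps)
    qed
    have "6 * (\<integral>\<omega>. (b \<bullet> \<omega>)\<^sup>2 * (b' \<bullet> \<omega>)\<^sup>2 \<partial>sphere_uniform)
        = (\<integral>\<omega>. 6 * ((b \<bullet> \<omega>)\<^sup>2 * (b' \<bullet> \<omega>)\<^sup>2) \<partial>sphere_uniform)" by simp
    also have "\<dots> = (\<integral>\<omega>. 2 * (?s \<bullet> \<omega>) ^ 4 + 2 * (?d \<bullet> \<omega>) ^ 4 - (b \<bullet> \<omega>) ^ 4 - (b' \<bullet> \<omega>) ^ 4 \<partial>sphere_uniform)"
      unfolding id by (simp add: inner_add_left inner_diff_left field_simps)
    also have "\<dots> = 2 * (\<integral>\<omega>. (?s \<bullet> \<omega>) ^ 4 \<partial>sphere_uniform) + 2 * (\<integral>\<omega>. (?d \<bullet> \<omega>) ^ 4 \<partial>sphere_uniform)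
        - (\<integral>\<omega>. (b \<bullet> \<omega>) ^ 4 \<partial>sphere_uniform) - (\<integral>\<omega>. (b' \<bullet> \<omega>) ^ 4 \<partial>sphere_uniform)"
      by (subst Bochner_Integration.integral_diff Bochner_Integration.integral_add integral_mult_right_zero;
          (intro int continuous_intros)?)+ simp
    also have "\<dots> = 2 * ?a + 2 * ?a - ?a - ?a"
      by (simp only: rot[OF ns(1)] rot[OF ns(2)] rot[OF norm_Basis[OF b(1)]] rot[OF norm_Basis[OF b(2)]])
    finally show ?thesis by simp
  qed
  have pure: "(\<integral>\<omega>. (b \<bullet> \<omega>)\<^sup>2 * (b \<bullet> \<omega>)\<^sup>2 \<partial>sphere_uniform) = ?a" if "b \<in> Basis" for b :: "real^'m"
    using sphere_moment_rotate[of b x 4] that x by (simp flip: power_add)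
  have "(1::real) = (\<integral>\<omega>. 1 \<partial>(sphere_uniform :: (real^'m) measure))"
    by (rule integral_sphere_uniform_const[symmetric])
  also have "\<dots> = (\<integral>\<omega>. (\<Sum>b\<in>Basis. \<Sum>b'\<in>Basis. (b \<bullet> \<omega>)\<^sup>2 * (b' \<bullet> \<omega>)\<^sup>2) \<partial>(sphere_uniform :: (real^'m) measure))"
  proof (rule integral_sphere_uniform_cong)
    fix \<omega> :: "real^'m" assume "norm \<omega> = 1"
    then have "(\<Sum>b\<in>Basis. (b \<bullet> \<omega>)\<^sup>2) = 1"
      using euclidean_inner[of \<omega> \<omega>] by (simp add: norm_eq_1 power2_eq_square inner_commute)
    then show "1 = (\<Sum>b\<in>Basis. \<Sum>b'\<in>Basis. (b \<bullet> \<omega>)\<^sup>2 * (b' \<bullet> \<omega>)\<^sup>2)"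
      by (simp flip: sum_product)
  qed (intro continuous_intros)+
  also have "\<dots> = (\<Sum>b\<in>(Basis::(real^'m) set). \<Sum>b'\<in>Basis. \<integral>\<omega>. (b \<bullet> \<omega>)\<^sup>2 * (b' \<bullet> \<omega>)\<^sup>2 \<partial>sphere_uniform)"
    by (subst Bochner_Integration.integral_sum, intro int continuous_intros)
      (intro sum.cong refl Bochner_Integration.integral_sum int continuous_intros)
  also have "\<dots> = (\<Sum>b\<in>(Basis::(real^'m) set). \<Sum>b'\<in>Basis. ?a / 3 + (if b' = b then 2 * ?a / 3 else 0))"
    using mixed pure by (intro sum.cong refl) auto
  also have "\<dots> = ?n * (?n * (?a / 3) + 2 * ?a / 3)"
    by (simp add: sum.distrib)
  finally have "?a * (?n * (?n + 2)) = 3" by (simp add: field_simps)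
  moreover have "?n * (?n + 2) > 0" by (simp add: add_pos_nonneg)
  ultimately show ?thesis by (simp add: field_simps)
qed


section \<open>Inner products of the tensor embeddings\<close>

definition outer :: "real^'m \<Rightarrow> real^'m \<Rightarrow> real^'m^'m" where
  "outer x y = (\<chi> i j. x $ i * y $ j)"

definition mean_tensor :: "real^('m::finite \<times> 'm)^('m \<times> 'm)" where
  "mean_tensor = (\<integral>\<omega>. tensor_op (Q1 \<omega>) (Q1 \<omega>) \<partial>(sphere_uniform :: (real^'m) measure))"

lemma bilinear_outer: "bilinear outer"
  by (simp add: bilinear_def linear_iff outer_def vec_eq_iff algebra_simps)

lemma bilinear_tensor_op: "bilinear tensor_op"
  by (simp add: bilinear_def linear_iff tensor_op_def vec_eq_iff algebra_simps)

lemma Q1_eq_outer: "Q1 x = outer x x - (1 / real CARD('m)) *\<^sub>R mat 1" for x :: "real^'m"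
  by (simp add: Q1_def outer_def matrix_def vec_eq_iff inner_axis' mult.commute)

lemma inner_outer_outer: "outer x x \<bullet> outer y y = (x \<bullet> y)\<^sup>2"
  by (simp add: outer_def inner_vec_def power2_eq_square sum_product mult_ac)

lemma inner_outer_mat_1: "outer x x \<bullet> mat 1 = x \<bullet> x"
  by (simp add: outer_def inner_vec_def mat_def if_distrib cong: if_cong)

lemma inner_mat_1_mat_1: "mat 1 \<bullet> (mat 1 :: real^'m^'m) = real CARD('m)"
  by (simp add: inner_vec_def mat_def if_distrib cong: if_cong)

lemma inner_Q1_Q1:
  fixes x y :: "real^'m"
  assumes "norm x = 1" "norm y = 1"
  shows "Q1 x \<bullet> Q1 y = (x \<bullet> y)\<^sup>2 - 1 / real CARD('m)"
  using assms
  by (simp add: Q1_eq_outer inner_diff_left inner_diff_right inner_outer_outer inner_outer_mat_1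
      inner_commute[of "mat 1" "outer _ _"] inner_mat_1_mat_1 norm_eq_1)

lemma inner_mat_1_Q1: "norm x = 1 \<Longrightarrow> mat 1 \<bullet> Q1 x = 0"
  by (simp add: Q1_eq_outer inner_diff_right inner_outer_mat_1
      inner_commute[of "mat 1" "outer _ _"] inner_mat_1_mat_1 norm_eq_1)

lemma inner_tensor_op:
  fixes A B C D :: "real^'m^'m"
  shows "tensor_op A B \<bullet> tensor_op C D = (A \<bullet> C) * (B \<bullet> D)"
proof -
  have prod: "(\<Sum>p\<in>UNIV. h p) = (\<Sum>i\<in>UNIV. \<Sum>j\<in>UNIV. h (i, j))" for h :: "'m \<times> 'm \<Rightarrow> real"
    by (simp add: sum.cartesian_product flip: UNIV_Times_UNIV)
  have "tensor_op A B \<bullet> tensor_op C D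
      = (\<Sum>p\<in>UNIV. \<Sum>q\<in>UNIV. (A $ fst p $ fst q * C $ fst p $ fst q) * (B $ snd p $ snd q * D $ snd p $ snd q))"
    by (simp add: tensor_op_def inner_vec_def mult_ac)
  also have "\<dots> = (\<Sum>i\<in>UNIV. \<Sum>j\<in>UNIV. \<Sum>k\<in>UNIV. \<Sum>l\<in>UNIV. (A $ i $ k * C $ i $ k) * (B $ j $ l * D $ j $ l))"
    by (simp add: prod)
  also have "\<dots> = (\<Sum>i\<in>UNIV. \<Sum>j\<in>UNIV. (A $ i \<bullet> C $ i) * (B $ j \<bullet> D $ j))"
    by (simp add: inner_vec_def sum_product)
  also have "\<dots> = (A \<bullet> C) * (B \<bullet> D)"
    by (simp add: inner_vec_def[of A] inner_vec_def[of B] sum_product)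
  finally show ?thesis .
qed

lemma Q1_mean_square:
  fixes x :: "real^'m"
  assumes x: "norm x = 1"
  shows "(\<integral>\<omega>. ((x \<bullet> \<omega>)\<^sup>2 - 1 / real CARD('m))\<^sup>2 \<partial>sphere_uniform)
    = 2 * (real CARD('m) - 1) / ((real CARD('m))\<^sup>2 * (real CARD('m) + 2))"
proof -
  let ?m = "real CARD('m)"
  interpret prob_space "sphere_uniform :: (real^'m) measure" by (rule prob_space_sphere_uniform)
  have int4: "integrable sphere_uniform (\<lambda>\<omega>. (x \<bullet> \<omega>) ^ 4)"
    and int2: "integrable sphere_uniform (\<lambda>\<omega>. (x \<bullet> \<omega>)\<^sup>2)"
    by (intro integrable_sphere_uniform_continuous continuous_intros)+
  have "(\<integral>\<omega>. ((x \<bullet> \<omega>)\<^sup>2 - 1 / ?m)\<^sup>2 \<partial>sphere_uniform)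
      = (\<integral>\<omega>. (x \<bullet> \<omega>) ^ 4 - (2 / ?m) * (x \<bullet> \<omega>)\<^sup>2 + 1 / ?m\<^sup>2 \<partial>sphere_uniform)"
    by (simp add: power2_diff power_divide algebra_simps flip: power_mult)
  also have "\<dots> = (\<integral>\<omega>. (x \<bullet> \<omega>) ^ 4 \<partial>sphere_uniform)
      - (2 / ?m) * (\<integral>\<omega>. (x \<bullet> \<omega>)\<^sup>2 \<partial>sphere_uniform) + 1 / ?m\<^sup>2"
    using int4 int2 by (simp add: prob_space)
  also have "\<dots> = 3 / (?m * (?m + 2)) - (2 / ?m) * (1 / ?m) + 1 / ?m\<^sup>2"
    using sphere_second_moment[OF x] sphere_fourth_moment[OF x] by simp
  also have "\<dots> = 2 * (?m - 1) / (?m\<^sup>2 * (?m + 2))"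
    by (simp add: divide_simps add_eq_0_iff_both_eq_0 power2_eq_square)
  finally show ?thesis .
qed

lemma inner_tensor_Q1_mean_tensor:
  fixes x :: "real^'m"
  assumes x: "norm x = 1"
  shows "tensor_op (Q1 x) (Q1 x) \<bullet> mean_tensor
    = 2 * (real CARD('m) - 1) / ((real CARD('m))\<^sup>2 * (real CARD('m) + 2))"
proof -
  let ?T = "\<lambda>\<omega>::real^'m. tensor_op (Q1 \<omega>) (Q1 \<omega>)"
  have "?T x \<bullet> mean_tensor = (\<integral>\<omega>. ?T x \<bullet> ?T \<omega> \<partial>sphere_uniform)"
    unfolding mean_tensor_def
    by (rule integral_inner_right[symmetric]) (use integrable_tensor_Q1 in auto)
  also have "\<dots> = (\<integral>\<omega>. ((x \<bullet> \<omega>)\<^sup>2 - 1 / real CARD('m))\<^sup>2 \<partial>sphere_uniform)"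
  proof (rule integral_cong_AE)
    show "AE \<omega> in sphere_uniform. ?T x \<bullet> ?T \<omega> = ((x \<bullet> \<omega>)\<^sup>2 - 1 / real CARD('m))\<^sup>2"
      using AE_sphere_uniform
      by eventually_elim (simp add: inner_tensor_op inner_Q1_Q1 x power2_eq_square)
    show "(\<lambda>\<omega>. ?T x \<bullet> ?T \<omega>) \<in> borel_measurable sphere_uniform"
      using integrable_tensor_Q1 by (intro borel_measurable_inner borel_measurable_const
          borel_measurable_integrable)
    show "(\<lambda>\<omega>. ((x \<bullet> \<omega>)\<^sup>2 - 1 / real CARD('m))\<^sup>2) \<in> borel_measurable sphere_uniform"
      by (intro borel_measurable_integrable integrable_sphere_uniform_continuous continuous_intros)
  qed
  finally show ?thesis using Q1_mean_square[OF x] by simp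
qed

lemma inner_mean_tensor_mean_tensor:
  "(mean_tensor :: real^('m::finite \<times> 'm)^('m \<times> 'm)) \<bullet> mean_tensor
    = 2 * (real CARD('m) - 1) / ((real CARD('m))\<^sup>2 * (real CARD('m) + 2))" (is "?E \<bullet> _ = ?c")
proof -
  let ?T = "\<lambda>\<omega>::real^'m. tensor_op (Q1 \<omega>) (Q1 \<omega>)"
  have "?E \<bullet> ?E = (\<integral>\<omega>. ?E \<bullet> ?T \<omega> \<partial>sphere_uniform)"
    by (subst (2) mean_tensor_def, rule integral_inner_right[symmetric])
      (use integrable_tensor_Q1 in auto)
  also have "\<dots> = (\<integral>\<omega>. ?c \<partial>(sphere_uniform :: (real^'m) measure))"
  proof (rule integral_cong_AE)
    show "AE \<omega> in sphere_uniform. ?E \<bullet> ?T \<omega> = ?c"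
      using AE_sphere_uniform
      by eventually_elim (metis inner_tensor_Q1_mean_tensor inner_commute)
    show "(\<lambda>\<omega>. ?E \<bullet> ?T \<omega>) \<in> borel_measurable sphere_uniform"
      using integrable_tensor_Q1 by (intro borel_measurable_inner borel_measurable_const
          borel_measurable_integrable)
  qed simp
  also have "\<dots> = ?c" by (rule integral_sphere_uniform_const)
  finally show ?thesis .
qed

lemma Q2_eq_mean_tensor: "Q2 x = tensor_op (Q1 x) (Q1 x) - mean_tensor"
  by (simp add: Q2_def mean_tensor_def)

lemma inner_Q2_mean_tensor: "norm x = 1 \<Longrightarrow> mean_tensor \<bullet> Q2 x = 0"
  by (simp add: Q2_eq_mean_tensor inner_diff_right inner_mean_tensor_mean_tensor
      inner_tensor_Q1_mean_tensor inner_commute[of mean_tensor "tensor_op _ _"])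

lemma inner_Q2_Q2:
  fixes x y :: "real^'m"
  assumes "norm x = 1" "norm y = 1"
  shows "Q2 x \<bullet> Q2 y = ((x \<bullet> y)\<^sup>2 - 1 / real CARD('m))\<^sup>2
    - 2 * (real CARD('m) - 1) / ((real CARD('m))\<^sup>2 * (real CARD('m) + 2))"
proof -
  have "Q2 x \<bullet> Q2 y = tensor_op (Q1 x) (Q1 x) \<bullet> Q2 y"
    using inner_Q2_mean_tensor[OF assms(2)] by (simp add: Q2_eq_mean_tensor[of x] inner_diff_left)
  then show ?thesis
    using assms by (simp add: Q2_eq_mean_tensor inner_diff_right inner_tensor_Q1_mean_tensor
        inner_tensor_op inner_Q1_Q1 power2_eq_square)
qed

lemma dim_Q1_sphere_le:
  "2 * (dim (Q1 ` sphere (0 :: real^'m) 1) + 1) \<le> CARD('m) * (CARD('m) + 1)"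
proof -
  let ?U = "range (\<lambda>x::real^'m. outer x x)"
  have mat1: "mat 1 \<in> span ?U"
  proof -
    have "mat 1 = (\<Sum>i\<in>UNIV. outer (axis i 1) (axis i 1 :: real^'m))"
    proof -
      have "outer (axis i 1) (axis i 1) $ a $ b = (if a = i then if b = i then 1 else 0 else 0)"
        for i a b :: 'm
        by (simp add: outer_def axis_def)
      then show ?thesis by (simp add: vec_eq_iff mat_def)
    qed
    also have "\<dots> \<in> span ?U" by (intro span_sum span_base) auto
    finally show ?thesis .
  qed
  have "dim (Q1 ` sphere (0 :: real^'m) 1) + 1 \<le> dim ?U"
  proof (rule dim_orthogonal_to_vector_less[OF _ mat1])
    show "Q1 ` sphere (0 :: real^'m) 1 \<subseteq> span ?U"
      by (auto simp: Q1_eq_outer intro!: span_diff[OF span_base span_scale[OF mat1]])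
    show "mat 1 \<noteq> (0 :: real^'m^'m)" using inner_mat_1_mat_1[where 'm='m] by fastforce
  qed (auto simp: inner_mat_1_Q1)
  moreover have "2 * dim ?U \<le> CARD('m) * (CARD('m) + 1)"
    using dim_bilinear_diagonal_le[OF bilinear_outer, of "UNIV :: (real^'m) set"] by simp
  ultimately show ?thesis by (meson le_trans mult_le_mono2)
qed

lemma dim_Q2_sphere_le:
  assumes "CARD('m) \<ge> 2"
  shows "2 * (dim (Q2 ` sphere (0 :: real^'m) 1) + 1)
    \<le> dim (Q1 ` sphere (0 :: real^'m) 1) * (dim (Q1 ` sphere (0 :: real^'m) 1) + 1)"
proof -
  let ?W = "Q1 ` sphere (0 :: real^'m) 1"
  let ?U = "(\<lambda>A. tensor_op A A) ` ?W"
  have E: "mean_tensor \<in> span ?U"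
    unfolding mean_tensor_def
  proof (rule integral_in_subspace_AE[OF subspace_span integrable_tensor_Q1])
    show "AE \<omega> in sphere_uniform. tensor_op (Q1 \<omega>) (Q1 \<omega>) \<in> span ?U"
      using AE_sphere_uniform by eventually_elim (auto intro!: span_base)
  qed
  have "dim (Q2 ` sphere (0 :: real^'m) 1) + 1 \<le> dim ?U"
  proof (rule dim_orthogonal_to_vector_less[OF _ E])
    show "Q2 ` sphere (0 :: real^'m) 1 \<subseteq> span ?U"
      by (auto simp: Q2_eq_mean_tensor intro!: span_diff[OF span_base E])
    have "(mean_tensor :: real^('m \<times> 'm)^('m \<times> 'm)) \<bullet> mean_tensor \<noteq> 0"
      using assms by (simp add: inner_mean_tensor_mean_tensor add_eq_0_iff_both_eq_0)
    then show "mean_tensor \<noteq> (0 :: real^('m \<times> 'm)^('m \<times> 'm))" by force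
  qed (auto simp: inner_Q2_mean_tensor)
  moreover have "2 * dim ?U \<le> dim ?W * (dim ?W + 1)"
    by (rule dim_bilinear_diagonal_le[OF bilinear_tensor_op])
  ultimately show ?thesis by (meson le_trans mult_le_mono2)
qed


section \<open>Comparing coherences\<close>

text \<open>Pairing the relation with \<open>Q2\<close> of \<open>y\<close>, \<open>z\<close> and \<open>(y + z) / sqrt 2\<close> gives three scalar
  equations that are inconsistent unless every \<open>g j\<close> with nonzero weight is orthogonal to \<open>y\<close>.\<close>

lemma Q2_nonneg_relation_orthogonal:
  fixes g :: "'i \<Rightarrow> real^'m"
  assumes I: "finite I" and g: "\<And>j. j \<in> I \<Longrightarrow> norm (g j) = 1"
    and c: "\<And>j. c j \<ge> 0" and rel: "(\<Sum>j\<in>I. c j *\<^sub>R Q2 (g j)) = 0"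
    and yz: "norm y = 1" "norm z = 1" "y \<bullet> z = 0"
    and disj: "\<And>j. j \<in> I \<Longrightarrow> c j \<noteq> 0 \<Longrightarrow> (g j \<bullet> y) * (g j \<bullet> z) = 0"
    and j: "j \<in> I" "c j \<noteq> 0"
  shows "g j \<bullet> y = 0"
proof -
  define a where "a = 1 / real CARD('m)"
  define k where "k = 2 * (real CARD('m) - 1) / ((real CARD('m))\<^sup>2 * (real CARD('m) + 2))"
  define w where "w = (y + z) /\<^sub>R sqrt 2"
  have "w \<bullet> w = 1"
    using yz by (simp add: w_def inner_add_left inner_add_right inner_commute[of z y] norm_eq_1
        field_simps)
  then have w: "norm w = 1" by (simp add: norm_eq_1)
  have eq: "(\<Sum>j\<in>I. c j * (((g j \<bullet> v)\<^sup>2 - a)\<^sup>2 - k)) = 0" if v: "norm v = 1" for v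
  proof -
    have "0 = (\<Sum>j\<in>I. c j *\<^sub>R Q2 (g j)) \<bullet> Q2 v" by (simp add: rel)
    also have "\<dots> = (\<Sum>j\<in>I. c j * (((g j \<bullet> v)\<^sup>2 - a)\<^sup>2 - k))"
      by (simp add: inner_sum_left inner_Q2_Q2 g v a_def k_def)
    finally show ?thesis by simp
  qed
  have w2: "(g j \<bullet> w)\<^sup>2 = ((g j \<bullet> y)\<^sup>2 + (g j \<bullet> z)\<^sup>2) / 2" if "j \<in> I" "c j \<noteq> 0" for j
    using disj[OF that]
    by (simp add: w_def inner_add_right power_mult_distrib power_divide power2_sum field_simps)
  have "(\<Sum>j\<in>I. c j * ((g j \<bullet> y) ^ 4 + (g j \<bullet> z) ^ 4))
      = (\<Sum>j\<in>I. 2 * (c j * (((g j \<bullet> y)\<^sup>2 - a)\<^sup>2 - k)) + 2 * (c j * (((g j \<bullet> z)\<^sup>2 - a)\<^sup>2 - k))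
          - 4 * (c j * (((g j \<bullet> w)\<^sup>2 - a)\<^sup>2 - k)))"
  proof (rule sum.cong)
    fix j assume j: "j \<in> I"
    show "c j * ((g j \<bullet> y) ^ 4 + (g j \<bullet> z) ^ 4)
      = 2 * (c j * (((g j \<bullet> y)\<^sup>2 - a)\<^sup>2 - k)) + 2 * (c j * (((g j \<bullet> z)\<^sup>2 - a)\<^sup>2 - k))
          - 4 * (c j * (((g j \<bullet> w)\<^sup>2 - a)\<^sup>2 - k))"
    proof (cases "c j = 0")
      case False
      define p q where "p = g j \<bullet> y" and "q = g j \<bullet> z"
      have "p * q = 0" using disj[OF j False] by (simp add: p_def q_def)
      then have "p = 0 \<or> q = 0" by simp
      then show ?thesis unfolding w2[OF j False] p_def[symmetric] q_def[symmetric]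
        by (auto simp: power4_eq_xxxx power2_eq_square field_simps)
    qed simp
  qed simp
  also have "\<dots> = 2 * (\<Sum>j\<in>I. c j * (((g j \<bullet> y)\<^sup>2 - a)\<^sup>2 - k))
      + 2 * (\<Sum>j\<in>I. c j * (((g j \<bullet> z)\<^sup>2 - a)\<^sup>2 - k))
      - 4 * (\<Sum>j\<in>I. c j * (((g j \<bullet> w)\<^sup>2 - a)\<^sup>2 - k))"
    by (simp only: sum.distrib sum_subtractf sum_distrib_left)
  also have "\<dots> = 0" using eq yz w by simp
  finally have "c j * ((g j \<bullet> y) ^ 4 + (g j \<bullet> z) ^ 4) = 0"
    using I j(1) c by (subst (asm) sum_nonneg_eq_0_iff) auto
  then have "(g j \<bullet> y) ^ 4 + (g j \<bullet> z) ^ 4 = 0" using j by simp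
  moreover have "(g j \<bullet> y) ^ 4 \<ge> 0" "(g j \<bullet> z) ^ 4 \<ge> 0" by simp_all
  ultimately have "(g j \<bullet> y) ^ 4 = 0" by linarith
  then show ?thesis by simp
qed

lemma finite_coherence_set:
  fixes f :: "nat \<Rightarrow> real^'m"
  shows "finite {\<bar>f j \<bullet> f l\<bar> | j l. j \<in> {1..n} \<and> l \<in> {1..n} \<and> j \<noteq> l}"
  by (rule finite_subset[of _ "(\<lambda>(j, l). \<bar>f j \<bullet> f l\<bar>) ` ({1..n} \<times> {1..n})"]) auto

lemma inner_le_coherence:
  "j \<in> {1..n} \<Longrightarrow> l \<in> {1..n} \<Longrightarrow> j \<noteq> l \<Longrightarrow> \<bar>f j \<bullet> f l\<bar> \<le> coherence n f"
  unfolding coherence_def by (intro Max_ge finite_coherence_set) auto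

lemma coherence_attained:
  assumes "n \<ge> 2"
  obtains j l where "j \<in> {1..n}" "l \<in> {1..n}" "j \<noteq> l" "coherence n f = \<bar>f j \<bullet> f l\<bar>"
proof -
  let ?S = "{\<bar>f j \<bullet> f l\<bar> | j l. j \<in> {1..n} \<and> l \<in> {1..n} \<and> j \<noteq> l}"
  have "\<bar>f 1 \<bullet> f 2\<bar> \<in> ?S"
    using assms by (intro CollectI exI[of _ 1] exI[of _ 2]) auto
  then have "Max ?S \<in> ?S" by (intro Max_in finite_coherence_set) auto
  then show ?thesis using that unfolding coherence_def by blast
qed

lemma smaller_coherence_deviation:
  fixes f g :: "nat \<Rightarrow> real^'m"
  assumes n: "n \<ge> 2" and \<beta>: "\<beta> \<ge> a" and a: "a > 0"
    and f: "\<And>j l. j \<in> {1..n} \<Longrightarrow> l \<in> {1..n} \<Longrightarrow> j \<noteq> l \<Longrightarrow> ((f j \<bullet> f l)\<^sup>2 - a)\<^sup>2 \<le> \<beta>\<^sup>2"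
    and less: "coherence n g < coherence n f"
    and jl: "j \<in> {1..n}" "l \<in> {1..n}" "j \<noteq> l"
  shows "((g j \<bullet> g l)\<^sup>2 - a)\<^sup>2 \<le> \<beta>\<^sup>2"
    and "((g j \<bullet> g l)\<^sup>2 - a)\<^sup>2 = \<beta>\<^sup>2 \<Longrightarrow> g j \<bullet> g l = 0"
proof -
  obtain p q where pq: "p \<in> {1..n}" "q \<in> {1..n}" "p \<noteq> q" "coherence n f = \<bar>f p \<bullet> f q\<bar>"
    by (rule coherence_attained[OF n])
  have "\<bar>g j \<bullet> g l\<bar> < \<bar>f p \<bullet> f q\<bar>"
    using inner_le_coherence[OF jl, of g] less pq(4) by linarith
  then have "(g j \<bullet> g l)\<^sup>2 < (f p \<bullet> f q)\<^sup>2"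
    by (metis abs_ge_zero power2_abs power_strict_mono pos2)
  moreover have "\<bar>(f p \<bullet> f q)\<^sup>2 - a\<bar> \<le> \<beta>"
    using f[OF pq(1-3)] \<beta> a by (subst (asm) abs_le_square_iff[symmetric]) simp
  ultimately have lt: "(g j \<bullet> g l)\<^sup>2 - a < \<beta>" by linarith
  then have "\<bar>(g j \<bullet> g l)\<^sup>2 - a\<bar> \<le> \<bar>\<beta>\<bar>" using \<beta> a zero_le_power2[of "g j \<bullet> g l"] by linarith
  then show "((g j \<bullet> g l)\<^sup>2 - a)\<^sup>2 \<le> \<beta>\<^sup>2" by (simp add: abs_le_square_iff)
  assume "((g j \<bullet> g l)\<^sup>2 - a)\<^sup>2 = \<beta>\<^sup>2"
  then have "(g j \<bullet> g l)\<^sup>2 - a = - \<beta>" using lt by (auto simp: power2_eq_iff)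
  then have "(g j \<bullet> g l)\<^sup>2 = 0" using \<beta> zero_le_power2[of "g j \<bullet> g l"] by linarith
  then show "g j \<bullet> g l = 0" by simp
qed

lemma card_le_unit_norm_frame:
  fixes f :: "nat \<Rightarrow> real^'m"
  assumes "unit_norm_frame n f"
  shows "CARD('m) \<le> n"
proof -
  have "CARD('m) = dim (span (f ` {1..n}))"
    using assms by (simp add: unit_norm_frame_def)
  also have "\<dots> \<le> card (f ` {1..n})" unfolding dim_span by (rule dim_le_card') simp
  also have "\<dots> \<le> n" using card_image_le[of "{1..n}" f] by simp
  finally show ?thesis .
qed

theorem theorem4p12:
  fixes f :: "nat \<Rightarrow> real^'m" and n m :: nat and d1 d2 :: real
  assumes m: "m = CARD('m)" "m \<ge> 2"
    and frame: "unit_norm_frame n f"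
    and d1: "d1 = (real m + 2) * (real m - 1) / 2"
    and d2: "d2 = 1 / 2 * (d1 + 2) * (d1 - 1)"
  shows
    "((real n - d1) / (real n - 1) \<ge> d1 / (real m - 1)\<^sup>2 \<and>
        (\<exists>V. subspace V \<and> V \<subseteq> self_adjoint_tensor_square \<and>
             forms_simplex_in V n (\<lambda>j. Q2 (f j)))
       \<longrightarrow> grassmannian_frame n f)
     \<and>
     (real n > d2 + 1 \<and> (real m - 1)\<^sup>2 \<ge> d1 \<and>
        (\<forall>j\<in>{1..n}. \<forall>l\<in>{1..n}. j \<noteq> l \<longrightarrow> hs_inner (Q2 (f j)) (Q2 (f l)) \<le> 0)
       \<longrightarrow> grassmannian_frame n f)"
proof (intro conjI impI; elim conjE exE)
  define M where "M = real m"
  define c0 where "c0 = 2 * (M - 1) / (M\<^sup>2 * (M + 2))"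
  define K where "K = (1 - 1 / M)\<^sup>2 - c0"
  have M: "M \<ge> 2" "M = real CARD('m)" using m by (simp_all add: M_def)
  have n: "n \<ge> 2" using card_le_unit_norm_frame[OF frame] m by simp
  have d1_ge: "d1 \<ge> 2"
    using mult_mono[of 4 "M + 2" 1 "M - 1"] M by (simp add: d1 M_def)
  have c0: "c0 = ((M - 1) / M)\<^sup>2 / d1"
    using M by (simp add: c0_def d1 flip: M_def) (simp add: divide_simps power2_eq_square)
  have K: "K = ((M - 1) / M)\<^sup>2 * (1 - 1 / d1)"
    using M by (simp add: K_def c0 diff_divide_distrib right_diff_distrib)
  have K_pos: "K > 0" unfolding K using M d1_ge by (intro mult_pos_pos) simp_all
  have kernel: "Q2 x \<bullet> Q2 y = ((x \<bullet> y)\<^sup>2 - 1 / M)\<^sup>2 - c0"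
    if "norm x = 1" "norm y = 1" for x y :: "real^'m"
    using that by (simp add: inner_Q2_Q2 c0_def M)
  have norm_Q2: "Q2 x \<bullet> Q2 x = K" if "norm x = 1" for x :: "real^'m"
    using that by (simp add: kernel K_def norm_eq_1)
  have fn: "norm (f j) = 1" if "j \<in> {1..n}" for j
    using frame that by (simp add: unit_norm_frame_def)
  {
    fix V
    assume ineq: "d1 / (real m - 1)\<^sup>2 \<le> (real n - d1) / (real n - 1)"
      and simplex: "forms_simplex_in V n (\<lambda>j. Q2 (f j))"
    define b where "b = - K / (real n - 1)"
    have "((M - 1) / M)\<^sup>2 / d1 * (d1 / (M - 1)\<^sup>2)
        \<le> ((M - 1) / M)\<^sup>2 / d1 * ((real n - d1) / (real n - 1))"
      using ineq d1_ge by (intro mult_left_mono) (simp_all add: M_def)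
    moreover have "((M - 1) / M)\<^sup>2 / d1 * (d1 / (M - 1)\<^sup>2) = (1 / M)\<^sup>2"
      using M d1_ge by (simp add: field_simps)
    moreover have "((M - 1) / M)\<^sup>2 / d1 * ((real n - d1) / (real n - 1)) = c0 + b"
    proof -
      have "((M - 1) / M)\<^sup>2 / d1 * ((real n - d1) / (real n - 1))
          = ((M - 1) / M)\<^sup>2 * ((1 / d1) * ((real n - d1) / (real n - 1)))" by simp
      also have "(1 / d1) * ((real n - d1) / (real n - 1)) = 1 / d1 - (1 - 1 / d1) / (real n - 1)"
        using n d1_ge by (simp add: field_simps)
      also have "((M - 1) / M)\<^sup>2 * \<dots> = c0 + b"
        by (simp add: b_def K c0 right_diff_distrib minus_divide_left)
      finally show ?thesis .
    qed
    ultimately have "(1 / M)\<^sup>2 \<le> c0 + b" by simp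
    then have \<beta>: "sqrt (c0 + b) \<ge> 1 / M" "(sqrt (c0 + b))\<^sup>2 = c0 + b"
      using order_trans[OF zero_le_power2] by (auto intro: real_le_rsqrt)
    have Q2f: "Q2 (f j) \<bullet> Q2 (f l) = b" if "j \<in> {1..n}" "l \<in> {1..n}" "j \<noteq> l" for j l
    proof -
      have "Q2 (f j) \<bullet> Q2 (f l) / (sqrt K * sqrt K) = - 1 / (real n - 1)"
        using simplex that
        by (simp add: forms_simplex_in_def hs_norm_def hs_inner_eq_inner norm_Q2 fn)
      then show ?thesis using K_pos n by (simp add: b_def field_simps)
    qed
    show "grassmannian_frame n f"
      unfolding grassmannian_frame_def
    proof (intro conjI allI impI frame, rule ccontr)
      fix g :: "nat \<Rightarrow> real^'m"
      assume "unit_norm_frame n g" and "\<not> coherence n f \<le> coherence n g"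
      then have gn: "\<And>j. j \<in> {1..n} \<Longrightarrow> norm (g j) = 1" and less: "coherence n g < coherence n f"
        by (simp_all add: unit_norm_frame_def)
      have "((f j \<bullet> f l)\<^sup>2 - 1 / M)\<^sup>2 \<le> (sqrt (c0 + b))\<^sup>2"
        if "j \<in> {1..n}" "l \<in> {1..n}" "j \<noteq> l" for j l
        using Q2f[OF that] that by (simp add: kernel fn \<beta>(2))
      note dev = smaller_coherence_deviation[OF n \<beta>(1) _ this less, unfolded \<beta>(2)]
      define S where "S = (\<Sum>j=1..n. Q2 (g j))"
      define e where "e = (\<lambda>j l. (if j = l then K else b) - Q2 (g j) \<bullet> Q2 (g l))"
      have e_nonneg: "e j l \<ge> 0" if "j \<in> {1..n}" "l \<in> {1..n}" for j l
      proof (cases "j = l")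
        case True
        then show ?thesis using that by (simp add: e_def norm_Q2 gn)
      next
        case False
        then show ?thesis using dev(1)[of j l] that M by (simp add: e_def kernel gn)
      qed
      have "(\<Sum>l=1..n. if j = l then K else b) = 0" if "j \<in> {1..n}" for j
      proof -
        have "(\<Sum>l=1..n. if j = l then K else b) = (\<Sum>l=1..n. b + (if j = l then K - b else 0))"
          by (rule sum.cong) auto
        also have "\<dots> = real n * b + (K - b)" using that by (simp add: sum.distrib)
        also have "\<dots> = 0" using n by (simp add: b_def field_simps)
        finally show ?thesis .
      qed
      moreover have "S \<bullet> S = (\<Sum>j=1..n. \<Sum>l=1..n. Q2 (g j) \<bullet> Q2 (g l))"
        by (simp only: S_def inner_sum_left) (simp only: inner_sum_right)
      ultimately have "(\<Sum>j=1..n. \<Sum>l=1..n. e j l) + S \<bullet> S = 0"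
        by (simp add: e_def sum_subtractf sum_negf)
      moreover have "(\<Sum>j=1..n. \<Sum>l=1..n. e j l) \<ge> 0"
        by (intro sum_nonneg e_nonneg)
      ultimately have "S \<bullet> S = 0" and e0: "(\<Sum>j=1..n. \<Sum>l=1..n. e j l) = 0"
        using inner_ge_zero[of S] by linarith+
      then have S: "S = 0" by simp
      have orth: "g j \<bullet> g l = 0" if jl: "j \<in> {1..n}" "l \<in> {1..n}" "j \<noteq> l" for j l
      proof -
        have "(\<Sum>l=1..n. e j l) = 0"
          using e0 e_nonneg jl by (subst (asm) sum_nonneg_eq_0_iff) (auto intro: sum_nonneg)
        then have "e j l = 0"
          using e_nonneg jl by (subst (asm) sum_nonneg_eq_0_iff) auto
        then show ?thesis using jl M by (intro dev(2)) (auto simp: e_def kernel gn)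
      qed
      have "g 1 \<bullet> g 1 = 0"
      proof (rule Q2_nonneg_relation_orthogonal[of "{1..n}" g "\<lambda>_. 1" "g 1" "g 2" 1])
        show "(g j \<bullet> g 1) * (g j \<bullet> g 2) = 0" if "j \<in> {1..n}" for j
          using orth[of j 1] orth[of j 2] that n by (cases "j = 1") auto
      qed (use n gn orth[of 1 2] S in \<open>auto simp: S_def\<close>)
      then show False using gn[of 1] n by (simp add: norm_eq_1)
    qed
  next
    assume card: "real n > d2 + 1" and ineq: "(real m - 1)\<^sup>2 \<ge> d1"
      and nonpos: "\<forall>j\<in>{1..n}. \<forall>l\<in>{1..n}. j \<noteq> l \<longrightarrow> hs_inner (Q2 (f j)) (Q2 (f l)) \<le> 0"
    have "(1 / M)\<^sup>2 \<le> c0"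
      using ineq d1_ge M by (simp add: c0 power_divide flip: M_def) (simp add: field_simps)
    then have \<beta>: "sqrt c0 \<ge> 1 / M" "(sqrt c0)\<^sup>2 = c0"
      using order_trans[OF zero_le_power2] by (auto intro: real_le_rsqrt)
    define p where "p = dim (Q1 ` sphere (0 :: real^'m) 1)"
    define q where "q = dim (Q2 ` sphere (0 :: real^'m) 1)"
    have "real (2 * (p + 1)) \<le> real (m * (m + 1))"
      using dim_Q1_sphere_le[where 'm='m] unfolding p_def m(1) of_nat_le_iff .
    then have p: "real p \<le> d1" by (simp add: d1 field_simps)
    have "real (2 * (q + 1)) \<le> real (p * (p + 1))"
      using dim_Q2_sphere_le[where 'm='m] m unfolding p_def q_def of_nat_le_iff by simp
    also have "\<dots> \<le> d1 * (d1 + 1)"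
      using p d1_ge by (simp only: of_nat_mult of_nat_add of_nat_1) (intro mult_mono, auto)
    finally have "real q \<le> d2" by (simp add: d2 field_simps)
    with card have q: "q < card {1..n - 1}" using n by simp
    show "grassmannian_frame n f"
      unfolding grassmannian_frame_def
    proof (intro conjI allI impI frame, rule ccontr)
      fix g :: "nat \<Rightarrow> real^'m"
      assume "unit_norm_frame n g" and "\<not> coherence n f \<le> coherence n g"
      then have gn: "\<And>j. j \<in> {1..n} \<Longrightarrow> norm (g j) = 1" and less: "coherence n g < coherence n f"
        by (simp_all add: unit_norm_frame_def)
      have "((f j \<bullet> f l)\<^sup>2 - 1 / M)\<^sup>2 \<le> (sqrt c0)\<^sup>2"
        if "j \<in> {1..n}" "l \<in> {1..n}" "j \<noteq> l" for j l
        using nonpos that kernel[of "f j" "f l"] by (fastforce simp: hs_inner_eq_inner fn \<beta>(2))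
      note dev = smaller_coherence_deviation[OF n \<beta>(1) _ this less, unfolded \<beta>(2)]
      have obtuse: "Q2 (g j) \<bullet> Q2 (g l) \<le> 0"
        if "j \<in> {1..n}" "l \<in> {1..n}" "j \<noteq> l" for j l
        using dev(1)[of j l] that M by (simp add: kernel gn)
      have "(\<lambda>j. Q2 (g j)) ` {1..n - 1} \<subseteq> Q2 ` sphere 0 1" using gn by auto
      then have "dim ((\<lambda>j. Q2 (g j)) ` {1..n - 1}) \<le> q"
        unfolding q_def by (rule dim_subset)
      then have dim: "dim ((\<lambda>j. Q2 (g j)) ` {1..n - 1}) < card {1..n - 1}" using q by simp
      obtain c where c: "\<And>j. c j \<ge> 0" "\<exists>j\<in>{1..n - 1}. c j \<noteq> 0"
        and rel: "(\<Sum>j\<in>{1..n - 1}. c j *\<^sub>R Q2 (g j)) = 0"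
        by (rule nonneg_linear_relation_if_obtuse[OF _ dim]) (use obtuse in auto)
      have orth: "g j \<bullet> g n = 0" if j: "j \<in> {1..n - 1}" "c j \<noteq> 0" for j
      proof -
        have "(\<Sum>j\<in>{1..n - 1}. c j * - (Q2 (g j) \<bullet> Q2 (g n))) = - ((\<Sum>j\<in>{1..n - 1}. c j *\<^sub>R Q2 (g j)) \<bullet> Q2 (g n))"
          by (simp add: inner_sum_left sum_negf)
        also have "\<dots> = 0" by (simp only: rel inner_zero_left minus_zero)
        finally have "(\<Sum>j\<in>{1..n - 1}. c j * - (Q2 (g j) \<bullet> Q2 (g n))) = 0" .
        moreover have "c j * - (Q2 (g j) \<bullet> Q2 (g n)) \<ge> 0" if "j \<in> {1..n - 1}" for j
          using obtuse[of j n] that n c(1) by (intro mult_nonneg_nonneg) auto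
        ultimately have "c j * - (Q2 (g j) \<bullet> Q2 (g n)) = 0"
          using j(1) by (subst (asm) sum_nonneg_eq_0_iff) auto
        then have "Q2 (g j) \<bullet> Q2 (g n) = 0" using j by simp
        then show ?thesis using j n M by (intro dev(2)) (auto simp: kernel gn)
      qed
      obtain i where i: "i \<in> {1..n - 1}" "c i \<noteq> 0" using c(2) by blast
      have "g i \<bullet> g i = 0"
        by (rule Q2_nonneg_relation_orthogonal[OF _ _ c(1) rel, of "g i" "g n" i])
          (use n gn orth i in auto)
      moreover have "i \<in> {1..n}" using i by auto
      ultimately show False using gn[of i] by (simp add: norm_eq_1)
    qed
  }
qed

end
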